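(* Let $\mathbb{F}$ be either $\mathbb{R}$ or $\mathbb{C}$. Let $A(\omega)\in\mathbb{F}^{n\times n}$ be a square matrix-valued function whose entries are analytic at $\omega_0\in\mathbb{C}$. Let $z_0$ be a simple eigenvalue of $A(\omega_0)$. Then there exist $\epsilon>0$ and $\delta>0$ and a function $z:D_\epsilon(\omega_0)\to D_\delta(z_0)$ such that, for each $\omega\in D_\epsilon(\omega_0)$, $z(\omega)$ is the unique eigenvalue of $A(\omega)$ lying in $D_\delta(z_0)$. Moreover, $z$ is analytic on $D_\epsilon(\omega_0)$ and, for each $\omega\in D_\epsilon(\omega_0)$, $$z'(\omega)=\frac{v(\omega)^\ast A'(\omega)u(\omega)}{v(\omega)^\ast u(\omega)},$$ where $u(\omega)$ and $v(\omega)$ are arbitrary right and left eigenvectors, respectively, of $A(\omega)$ for $z(\omega)$.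
   Context: $D_\epsilon(z_0)$ denotes the open disc in $\mathbb{C}$ of radius $\epsilon>0$ with center $z_0$. A simple eigenvalue is an eigenvalue that is a simple root of the characteristic polynomial. For $M\in\mathbb{C}^{n\times n}$ and an eigenvalue $z_0$ of $M$, a right eigenvector is a nonzero $u\in\mathbb{C}^{n\times 1}$ with $Mu=z_0u$, and a left eigenvector is a nonzero $v\in\mathbb{C}^{n\times1}$ with $v^\ast M=z_0v^\ast$, where $v^\ast=\bar v^T$ is the conjugate transpose of $v$. $A'(\omega)$ is the entrywise derivative of $A$ with respect to $\omega$. No regularity (e.g. continuity) of $u(\omega)$, $v(\omega)$ as functions of $\omega$ is assumed. *)

theory Defs
  imports "HOL-Complex_Analysis.Complex_Analysis" "Jordan_Normal_Form.Schur_Decomposition"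
begin

text \<open>Both libraries use the same dot for their products; here it denotes \<^const>\<open>scalar_prod\<close>,
  which is bilinear, so \<open>v\<^sup>* x\<close> is \<open>conjugate v \<bullet> x\<close>.\<close>

unbundle no inner_syntax

definition simple_eigenvalue :: "complex mat \<Rightarrow> complex \<Rightarrow> bool" where
  "simple_eigenvalue M z \<longleftrightarrow> eigenvalue M z \<and> Polynomial.order z (char_poly M) = 1"

text \<open>The \<open>1 \<times> n\<close> matrix \<open>v\<^sup>*\<close> is \<open>mat_of_row (conjugate v)\<close>.\<close>

definition left_eigenvector :: "complex mat \<Rightarrow> complex vec \<Rightarrow> complex \<Rightarrow> bool" where
  "left_eigenvector M v z \<longleftrightarrow>
     v \<in> carrier_vec (dim_row M) \<and> v \<noteq> 0\<^sub>v (dim_row M) \<and>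
     mat_of_row (conjugate v) * M = z \<cdot>\<^sub>m mat_of_row (conjugate v)"

definition mat_deriv :: "(complex \<Rightarrow> complex mat) \<Rightarrow> complex \<Rightarrow> complex mat" where
  "mat_deriv A \<omega> =
     Matrix.mat (dim_row (A \<omega>)) (dim_col (A \<omega>)) (\<lambda>(i, j). deriv (\<lambda>w. A w $$ (i, j)) \<omega>)"

end

theory Submission
  imports Defs
begin

text \<open>
The eigenvalues of \<open>A \<omega>\<close> are the roots of a polynomial whose coefficients are holomorphic in
\<open>\<omega>\<close>, so the existence, uniqueness and holomorphy of \<open>z\<close> are statements about a simple root of a
polynomial family (\<open>simple_root_holomorphic\<close>). The factorization
\<open>p(a) - p(b) = (a - b) q(a, b)\<close> governs all of it: \<open>q\<close> is jointly continuous in \<open>a\<close>, \<open>b\<close> and the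
coefficients of \<open>p\<close>, and \<open>q(a, a) = p'(a)\<close>, so near a simple root \<open>|q|\<close> is bounded below. This
bound makes the polynomials injective near the root, forces a root to exist because the value at
the centre of a small disc is smaller than the values on its boundary, and makes the root
differentiable.

For the derivative formula \<open>v\<^sup>* u z' = v\<^sup>* A' u\<close> one would like to differentiate
\<open>A(x) u(x) = z(x) u(x)\<close> and multiply by \<open>v\<^sup>*\<close> from the left, which kills \<open>u'\<close>. Eigenvectors chosen
pointwise may fail to be differentiable, or even continuous. But multiplying by \<open>v\<^sup>*\<close> before
passing to the limit \<open>x \<rightarrow> w\<close> gives \<open>v\<^sup>* (A(x) - A(w)) r(x) = (z(x) - z(w)) v\<^sup>* r(x)\<close> for every
solution \<open>r\<close> of the eigenvalue equation, and then continuity of \<open>r\<close> at \<open>w\<close> is enough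
(\<open>first_order_eigenvalue_perturbation\<close>). Applying the adjugate of \<open>z(x) I - A(x)\<close> to the fixed
vector \<open>u\<close> gives such a continuous solution; its value at \<open>w\<close> is a multiple of \<open>u\<close>, the factor
being the derivative of the characteristic polynomial at \<open>z(w)\<close> (\<open>adj_mat_eigenvector\<close>), which
is nonzero. So the formula holds with the given \<open>u\<close> (\<open>eigenvalue_derivative\<close>).

Finally \<open>v\<^sup>* u \<noteq> 0\<close> follows from the same formula applied to another family: along
\<open>s \<mapsto> M + s v u\<^sup>*\<close> it reads \<open>v\<^sup>* u z'(0) = (v\<^sup>* v) (u\<^sup>* u)\<close>, whose right-hand side is nonzero
(\<open>left_right_eigenvectors_not_orthogonal\<close>).
\<close>

section \<open>Simple roots of holomorphic families of polynomials\<close>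

text \<open>The cofactor \<open>q\<close> in \<open>p(a) - p(b) = (a - b) q(a, b)\<close> for polynomials of degree at most \<open>n\<close>.
  Dividing by \<open>a - b\<close> would lose the diagonal; the explicit sum is continuous there too, and its
  dependence on the coefficients is visible.\<close>

definition poly_diff_quot :: "nat \<Rightarrow> complex poly \<Rightarrow> complex \<Rightarrow> complex \<Rightarrow> complex" where
  "poly_diff_quot n p a b =
     (\<Sum>k\<le>n. coeff p k * (\<Sum>i<k. b ^ (k - Suc i) * a ^ i))"

lemma poly_diff_quot:
  assumes "degree p \<le> n"
  shows "poly p a - poly p b = (a - b) * poly_diff_quot n p a b"
proof -
  have ev: "poly p x = (\<Sum>k\<le>n. coeff p k * x ^ k)" for x
    unfolding poly_altdef using assms
    by (intro sum.mono_neutral_left) (auto simp: coeff_eq_0)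
  have "poly p a - poly p b = (\<Sum>k\<le>n. coeff p k * (a ^ k - b ^ k))"
    by (simp add: ev sum_subtractf right_diff_distrib)
  then show ?thesis
    by (simp add: poly_diff_quot_def power_diff_sumr2 sum_distrib_left mult_ac)
qed

lemma poly_diff_quot_diagonal:
  assumes "degree p \<le> n"
  shows "poly_diff_quot n p a a = poly (pderiv p) a"
proof -
  have "isCont (\<lambda>x. poly_diff_quot n p x a) a"
    unfolding poly_diff_quot_def by (intro continuous_intros)
  then have "DERIV (poly p) a :> poly_diff_quot n p a a"
    unfolding CARAT_DERIV using poly_diff_quot[OF assms] by (metis mult.commute)
  then show ?thesis
    using poly_DERIV DERIV_unique by blast
qed

text \<open>A one-variable holomorphic implicit function theorem. Everything rests on a lower bound \<open>m\<close> for
  the difference quotient \<open>Q\<close> near \<open>(\<omega>\<^sub>0, z\<^sub>0, z\<^sub>0)\<close>, where its value is the nonzero derivative. The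
  bound also shows that the nearby roots remain simple.\<close>

proposition simple_root_holomorphic:
  fixes p :: "complex \<Rightarrow> complex poly"
  assumes S: "open S" "\<omega>\<^sub>0 \<in> S"
    and deg: "\<And>\<omega>. \<omega> \<in> S \<Longrightarrow> degree (p \<omega>) \<le> n"
    and hol: "\<And>k. (\<lambda>\<omega>. coeff (p \<omega>) k) holomorphic_on S"
    and root: "poly (p \<omega>\<^sub>0) z\<^sub>0 = 0"
    and simple: "poly (pderiv (p \<omega>\<^sub>0)) z\<^sub>0 \<noteq> 0"
  obtains \<epsilon> \<delta> z where "\<epsilon> > 0" "\<delta> > 0" "ball \<omega>\<^sub>0 \<epsilon> \<subseteq> S" "z holomorphic_on ball \<omega>\<^sub>0 \<epsilon>"
    "\<And>\<omega>. \<omega> \<in> ball \<omega>\<^sub>0 \<epsilon> \<Longrightarrow> z \<omega> \<in> ball z\<^sub>0 \<delta>"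
    "\<And>\<omega>. \<omega> \<in> ball \<omega>\<^sub>0 \<epsilon> \<Longrightarrow> poly (p \<omega>) (z \<omega>) = 0"
    "\<And>\<omega>. \<omega> \<in> ball \<omega>\<^sub>0 \<epsilon> \<Longrightarrow> poly (pderiv (p \<omega>)) (z \<omega>) \<noteq> 0"
    "\<And>\<omega> \<mu>. \<omega> \<in> ball \<omega>\<^sub>0 \<epsilon> \<Longrightarrow> \<mu> \<in> ball z\<^sub>0 \<delta> \<Longrightarrow> poly (p \<omega>) \<mu> = 0 \<Longrightarrow> \<mu> = z \<omega>"
proof -
  define Q where "Q = (\<lambda>\<omega> a b. poly_diff_quot n (p \<omega>) a b)"
  have diff: "poly (p \<omega>) a - poly (p \<omega>) b = (a - b) * Q \<omega> a b" if "\<omega> \<in> S" for \<omega> a b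
    unfolding Q_def by (rule poly_diff_quot[OF deg[OF that]])
  have diag: "Q \<omega> a a = poly (pderiv (p \<omega>)) a" if "\<omega> \<in> S" for \<omega> a
    unfolding Q_def by (rule poly_diff_quot_diagonal[OF deg[OF that]])
  have coeff_tendsto: "((\<lambda>x. coeff (p (f x)) k) \<longlongrightarrow> coeff (p \<omega>) k) G"
    if "(f \<longlongrightarrow> \<omega>) G" "\<omega> \<in> S" for f :: "'b \<Rightarrow> complex" and G \<omega> k
  proof -
    have "isCont (\<lambda>\<omega>. coeff (p \<omega>) k) \<omega>"
      using holomorphic_on_imp_continuous_on[OF hol] S(1) that(2)
      by (simp add: continuous_on_eq_continuous_at)
    then show ?thesis
      using that(1) by (rule isCont_tendsto_compose)
  qed
  have Q_tendsto: "((\<lambda>x. Q (f x) (g x) (h x)) \<longlongrightarrow> Q \<omega> a b) G"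
    if "(f \<longlongrightarrow> \<omega>) G" "(g \<longlongrightarrow> a) G" "(h \<longlongrightarrow> b) G" "\<omega> \<in> S"
    for f g h :: "'b \<Rightarrow> complex" and G \<omega> a b
    unfolding Q_def poly_diff_quot_def by (intro tendsto_intros coeff_tendsto that)
  have poly_hol: "(\<lambda>\<omega>. poly (p \<omega>) a) holomorphic_on S" for a
  proof -
    have "(\<lambda>\<omega>. \<Sum>k\<le>n. coeff (p \<omega>) k * a ^ k) holomorphic_on S"
      by (intro holomorphic_intros hol)
    moreover have "poly (p \<omega>) a = (\<Sum>k\<le>n. coeff (p \<omega>) k * a ^ k)" if "\<omega> \<in> S" for \<omega>
      unfolding poly_altdef using deg[OF that]
      by (intro sum.mono_neutral_left) (auto simp: coeff_eq_0)
    ultimately show ?thesis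
      by (simp cong: holomorphic_cong)
  qed
  have poly_tendsto: "((\<lambda>x. poly (p x) a) \<longlongrightarrow> poly (p \<omega>) a) (at \<omega>)" if "\<omega> \<in> S" for \<omega> a
    using holomorphic_on_imp_continuous_on[OF poly_hol, of a] S(1) that
    by (simp add: continuous_on_eq_continuous_at isCont_def)

  \<comment> \<open>The lower bound, valid for \<open>\<omega>\<close> near \<open>\<omega>\<^sub>0\<close> and both points in a closed disc around \<open>z\<^sub>0\<close>. Halving
    \<open>d\<close> makes room for the boundary of the disc.\<close>
  define m where "m = norm (Q \<omega>\<^sub>0 z\<^sub>0 z\<^sub>0) / 2"
  have m: "m > 0" "m < norm (Q \<omega>\<^sub>0 z\<^sub>0 z\<^sub>0)"
    using simple S by (auto simp: m_def diag)
  have "((\<lambda>x. Q (fst x) (fst (snd x)) (snd (snd x))) \<longlongrightarrow> Q \<omega>\<^sub>0 z\<^sub>0 z\<^sub>0) (nhds (\<omega>\<^sub>0, z\<^sub>0, z\<^sub>0))"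
    by (rule Q_tendsto)
       (use S in \<open>auto intro!: tendsto_eq_intros filterlim_ident\<close>)
  then have "\<forall>\<^sub>F x in nhds (\<omega>\<^sub>0, z\<^sub>0, z\<^sub>0). m < norm (Q (fst x) (fst (snd x)) (snd (snd x)))"
    using order_tendstoD(1)[OF tendsto_norm m(2)] by blast
  then obtain P R where PR: "eventually P (nhds \<omega>\<^sub>0)" "eventually R (nhds (z\<^sub>0, z\<^sub>0))"
      "\<And>\<omega> y. P \<omega> \<Longrightarrow> R y \<Longrightarrow> m < norm (Q \<omega> (fst y) (snd y))"
    unfolding nhds_prod[of \<omega>\<^sub>0] eventually_prod_filter by auto
  from PR(2) obtain R1 R2 where R12: "eventually R1 (nhds z\<^sub>0)" "eventually R2 (nhds z\<^sub>0)"
      "\<And>a b. R1 a \<Longrightarrow> R2 b \<Longrightarrow> R (a, b)"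
    unfolding nhds_prod eventually_prod_filter by auto
  from eventually_conj[OF R12(1,2)] obtain d where d: "d > 0"
      "\<And>a. dist a z\<^sub>0 < d \<Longrightarrow> R1 a \<and> R2 a"
    unfolding eventually_nhds_metric by auto
  define \<delta> where "\<delta> = d / 2"
  have \<delta>: "\<delta> > 0" using d by (simp add: \<delta>_def)
  have near: "m < norm (Q \<omega> a b)" if "P \<omega>" "a \<in> cball z\<^sub>0 \<delta>" "b \<in> cball z\<^sub>0 \<delta>" for \<omega> a b
    using PR(3)[of \<omega> "(a, b)"] R12(3) d that by (auto simp: \<delta>_def dist_commute)

  \<comment> \<open>On the boundary of the disc \<open>p \<omega>\<close> differs from its value at the centre by at least \<open>m * \<delta>\<close>, so
    it dominates that value as soon as the latter is below half of this.\<close>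
  have "((\<lambda>\<omega>. poly (p \<omega>) z\<^sub>0) \<longlongrightarrow> 0) (nhds \<omega>\<^sub>0)"
    using poly_tendsto[OF S(2), of z\<^sub>0] root by (metis tendsto_at_iff_tendsto_nhds)
  then have "\<forall>\<^sub>F \<omega> in nhds \<omega>\<^sub>0. norm (poly (p \<omega>) z\<^sub>0) < m * \<delta> / 2"
    by (rule order_tendstoD(2)[OF tendsto_norm_zero]) (use m \<delta> in simp)
  then have "\<forall>\<^sub>F \<omega> in nhds \<omega>\<^sub>0. norm (poly (p \<omega>) z\<^sub>0) < m * \<delta> / 2 \<and> P \<omega> \<and> \<omega> \<in> S"
    using PR(1) S by (intro eventually_conj) (auto simp: eventually_nhds_in_open)
  then obtain \<epsilon> where \<epsilon>: "\<epsilon> > 0" and \<epsilon>': "\<And>\<omega>. \<omega> \<in> ball \<omega>\<^sub>0 \<epsilon> \<Longrightarrow>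
      norm (poly (p \<omega>) z\<^sub>0) < m * \<delta> / 2 \<and> P \<omega> \<and> \<omega> \<in> S"
    unfolding eventually_nhds_metric by (auto simp: dist_commute)
  have lower: "m * norm (a - b) \<le> norm (poly (p \<omega>) a - poly (p \<omega>) b)"
    if "\<omega> \<in> ball \<omega>\<^sub>0 \<epsilon>" "a \<in> cball z\<^sub>0 \<delta>" "b \<in> cball z\<^sub>0 \<delta>" for \<omega> a b
  proof -
    have "m * norm (a - b) \<le> norm (Q \<omega> a b) * norm (a - b)"
      using near[of \<omega> a b] \<epsilon>'[of \<omega>] that by (intro mult_right_mono) auto
    then show ?thesis
      using diff[of \<omega> a b] \<epsilon>'[of \<omega>] that(1) by (simp add: norm_mult mult.commute)
  qed

  have "\<exists>\<mu>\<in>ball z\<^sub>0 \<delta>. poly (p \<omega>) \<mu> = 0" if \<omega>: "\<omega> \<in> ball \<omega>\<^sub>0 \<epsilon>" for \<omega>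
  proof -
    have "norm (poly (p \<omega>) z\<^sub>0) < norm (poly (p \<omega>) \<mu>)" if "norm (z\<^sub>0 - \<mu>) = \<delta>" for \<mu>
    proof -
      have "m * \<delta> \<le> norm (poly (p \<omega>) z\<^sub>0 - poly (p \<omega>) \<mu>)"
        using lower[OF \<omega>, of z\<^sub>0 \<mu>] that \<delta> by (auto simp: dist_norm)
      also have "\<dots> \<le> norm (poly (p \<omega>) z\<^sub>0) + norm (poly (p \<omega>) \<mu>)"
        by (rule norm_triangle_ineq4)
      finally show ?thesis
        using \<epsilon>'[OF \<omega>] by linarith
    qed
    moreover have hol_poly: "poly (p \<omega>) holomorphic_on X" for X
      using poly_DERIV[of "p \<omega>"] DERIV_subset holomorphic_onI field_differentiable_def subset_UNIV
      by metis
    ultimately obtain \<mu> where "\<mu> \<in> ball z\<^sub>0 \<delta>" "poly (p \<omega>) \<mu> = 0"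
      using holomorphic_contract_to_zero[OF holomorphic_on_imp_continuous_on[OF hol_poly] hol_poly \<delta>]
      by blast
    then show ?thesis by blast
  qed
  then obtain z where z: "\<And>\<omega>. \<omega> \<in> ball \<omega>\<^sub>0 \<epsilon> \<Longrightarrow> z \<omega> \<in> ball z\<^sub>0 \<delta>"
      "\<And>\<omega>. \<omega> \<in> ball \<omega>\<^sub>0 \<epsilon> \<Longrightarrow> poly (p \<omega>) (z \<omega>) = 0"
    by metis
  have z': "z \<omega> \<in> cball z\<^sub>0 \<delta>" if "\<omega> \<in> ball \<omega>\<^sub>0 \<epsilon>" for \<omega>
    using z(1)[OF that] by auto
  have unique: "\<mu> = z \<omega>" if "\<omega> \<in> ball \<omega>\<^sub>0 \<epsilon>" "\<mu> \<in> ball z\<^sub>0 \<delta>" "poly (p \<omega>) \<mu> = 0" for \<omega> \<mu>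
    using lower[OF that(1) _ z'[OF that(1)], of \<mu>] that z m
    by (auto simp: mult_le_0_iff)
  have simple': "poly (pderiv (p \<omega>)) (z \<omega>) \<noteq> 0" if "\<omega> \<in> ball \<omega>\<^sub>0 \<epsilon>" for \<omega>
    using near[of \<omega> "z \<omega>" "z \<omega>"] \<epsilon>'[OF that] z'[OF that] m diag[of \<omega> "z \<omega>"] by force

  have "z field_differentiable (at \<omega>)" if \<omega>: "\<omega> \<in> ball \<omega>\<^sub>0 \<epsilon>" for \<omega>
  proof -
    have \<omega>S: "\<omega> \<in> S" using \<epsilon>'[OF \<omega>] by blast
    have ev: "\<forall>\<^sub>F x in at \<omega>. x \<in> ball \<omega>\<^sub>0 \<epsilon>"
      by (rule eventually_at_in_open'[OF open_ball \<omega>])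
    \<comment> \<open>Continuity comes first: the lower bound controls \<open>z x - z \<omega>\<close> by the value of \<open>p x\<close> at the
      fixed point \<open>z \<omega>\<close>. It is needed for the limit of \<open>Q x (z x) (z \<omega>)\<close>, the denominator below.\<close>
    have "(z \<longlongrightarrow> z \<omega>) (at \<omega>)"
    proof (rule LIM_zero_cancel, rule Lim_transform_bound)
      show "\<forall>\<^sub>F x in at \<omega>. norm (z x - z \<omega>) \<le> norm (poly (p x) (z \<omega>) / m)"
        using ev
      proof eventually_elim
        case (elim x)
        then show ?case
          using lower[OF elim z'[OF elim] z'[OF \<omega>]] z(2)[OF elim] m
          by (simp add: norm_divide field_simps)
      qed
      show "((\<lambda>x. poly (p x) (z \<omega>) / m) \<longlongrightarrow> 0) (at \<omega>)"
        using poly_tendsto[OF \<omega>S, of "z \<omega>"] z(2)[OF \<omega>] m by (auto intro!: tendsto_eq_intros)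
    qed
    then have den: "((\<lambda>x. Q x (z x) (z \<omega>)) \<longlongrightarrow> Q \<omega> (z \<omega>) (z \<omega>)) (at \<omega>)"
      by (intro Q_tendsto \<omega>S tendsto_intros)
    obtain D where "DERIV (\<lambda>x. poly (p x) (z \<omega>)) \<omega> :> D"
      using poly_hol[of "z \<omega>"] S(1) \<omega>S
      by (meson field_differentiable_def holomorphic_on_imp_differentiable_at)
    then have num: "((\<lambda>x. poly (p x) (z \<omega>) / (x - \<omega>)) \<longlongrightarrow> D) (at \<omega>)"
      using z(2)[OF \<omega>] by (simp add: has_field_derivative_iff)
    have "((\<lambda>x. - (poly (p x) (z \<omega>) / (x - \<omega>)) / Q x (z x) (z \<omega>))
        \<longlongrightarrow> - D / Q \<omega> (z \<omega>) (z \<omega>)) (at \<omega>)"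
      using num den simple'[OF \<omega>] diag[OF \<omega>S] by (intro tendsto_intros) auto
    moreover have "\<forall>\<^sub>F x in at \<omega>. - (poly (p x) (z \<omega>) / (x - \<omega>)) / Q x (z x) (z \<omega>)
        = (z x - z \<omega>) / (x - \<omega>)"
      using ev
    proof eventually_elim
      case (elim x)
      have "Q x (z x) (z \<omega>) \<noteq> 0"
        using near[of x "z x" "z \<omega>"] \<epsilon>'[OF elim] z'[OF elim] z'[OF \<omega>] m by force
      moreover have "- poly (p x) (z \<omega>) = (z x - z \<omega>) * Q x (z x) (z \<omega>)"
        using diff[of x "z x" "z \<omega>"] \<epsilon>'[OF elim] z(2)[OF elim] by simp
      ultimately show ?case
        by (simp add: divide_simps)
    qed
    ultimately have "DERIV z \<omega> :> - D / Q \<omega> (z \<omega>) (z \<omega>)"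
      unfolding has_field_derivative_iff by (rule Lim_transform_eventually)
    then show ?thesis
      by (auto simp: field_differentiable_def)
  qed
  then have "z holomorphic_on ball \<omega>\<^sub>0 \<epsilon>"
    by (simp add: holomorphic_on_def field_differentiable_at_within)
  then show thesis
    using that[OF \<epsilon> \<delta> _ _ z(1) z(2) simple' unique] \<epsilon>' by blast
qed

section \<open>Holomorphy of the characteristic polynomial\<close>

lemma coeff_mult_holomorphic:
  fixes p q :: "complex \<Rightarrow> complex poly"
  assumes "\<And>k. (\<lambda>\<omega>. coeff (p \<omega>) k) holomorphic_on S" "\<And>k. (\<lambda>\<omega>. coeff (q \<omega>) k) holomorphic_on S"
  shows "(\<lambda>\<omega>. coeff (p \<omega> * q \<omega>) k) holomorphic_on S"
  unfolding coeff_mult by (intro holomorphic_intros assms)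

lemma coeff_prod_holomorphic:
  fixes p :: "'i \<Rightarrow> complex \<Rightarrow> complex poly"
  assumes "\<And>i k. i \<in> I \<Longrightarrow> (\<lambda>\<omega>. coeff (p i \<omega>) k) holomorphic_on S"
  shows "(\<lambda>\<omega>. coeff (\<Prod>i\<in>I. p i \<omega>) k) holomorphic_on S"
  using assms
proof (induction I arbitrary: k rule: infinite_finite_induct)
  case (insert i I)
  then show ?case
    by (simp add: coeff_mult_holomorphic)
qed (simp_all add: holomorphic_on_const)

lemma coeff_det_holomorphic:
  fixes B :: "complex \<Rightarrow> complex poly mat"
  assumes "\<And>\<omega>. B \<omega> \<in> carrier_mat n n"
    and "\<And>i j k. i < n \<Longrightarrow> j < n \<Longrightarrow> (\<lambda>\<omega>. coeff (B \<omega> $$ (i, j)) k) holomorphic_on S"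
  shows "(\<lambda>\<omega>. coeff (det (B \<omega>)) k) holomorphic_on S"
proof -
  have "(\<lambda>\<omega>. coeff (\<Prod>i = 0..<n. B \<omega> $$ (i, \<pi> i)) k) holomorphic_on S"
    if "\<pi> permutes {0..<n}" for \<pi> k
    using assms(2) permutes_in_image[OF that]
    by (intro coeff_prod_holomorphic) (metis atLeastLessThan_iff le0)
  then show ?thesis
    unfolding det_def'[OF assms(1)] coeff_sum
    by (intro holomorphic_intros coeff_mult_holomorphic) (simp_all add: holomorphic_on_const)
qed

lemma coeff_char_poly_holomorphic:
  assumes "\<And>\<omega>. \<omega> \<in> S \<Longrightarrow> A \<omega> \<in> carrier_mat n n"
    and "\<And>i j. i < n \<Longrightarrow> j < n \<Longrightarrow> (\<lambda>\<omega>. A \<omega> $$ (i, j)) holomorphic_on S"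
  shows "(\<lambda>\<omega>. coeff (char_poly (A \<omega>)) k) holomorphic_on S"
proof -
  \<comment> \<open>The characteristic matrix rebuilt with constant dimension, since \<open>A\<close> is an \<open>n \<times> n\<close> matrix only
    on \<open>S\<close>.\<close>
  define B where "B = (\<lambda>\<omega>. Matrix.mat n n
    (\<lambda>(i, j). (if i = j then [:0, 1:] else 0) + [:- A \<omega> $$ (i, j):]))"
  have "coeff (char_poly (A \<omega>)) k = coeff (det (B \<omega>)) k" if "\<omega> \<in> S" for \<omega>
  proof -
    have "char_poly_matrix (A \<omega>) = B \<omega>"
      using assms(1)[OF that] by (intro eq_matI) (auto simp: char_poly_matrix_def B_def)
    then show ?thesis by (simp add: char_poly_def)
  qed
  moreover have "(\<lambda>\<omega>. coeff (det (B \<omega>)) k) holomorphic_on S"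
    using assms(2)
    by (intro coeff_det_holomorphic[where n = n])
       (auto simp: B_def coeff_pCons split: nat.split intro!: holomorphic_intros)
  ultimately show ?thesis
    by (simp cong: holomorphic_cong)
qed

lemma simple_eigenvalue_imp_pderiv_char_poly_nonzero:
  assumes "M \<in> carrier_mat n n" "simple_eigenvalue M z"
  shows "poly (pderiv (char_poly M)) z \<noteq> 0"
proof -
  have "char_poly M \<noteq> 0" "Polynomial.order z (char_poly M) = 1"
    using degree_monic_char_poly[OF assms(1)] assms(2) by (auto simp: simple_eigenvalue_def)
  then obtain q where "char_poly M = [:- z, 1:] * q" "\<not> [:- z, 1:] dvd q"
    using order_decomp[of "char_poly M" z] by auto
  moreover have "poly (pderiv ([:- z, 1:] * q)) z = poly q z"
    unfolding pderiv_mult by (simp add: pderiv_pCons)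
  ultimately show ?thesis
    by (simp add: poly_eq_0_iff_dvd)
qed

section \<open>Continuity of the adjugate\<close>

lemma tendsto_det:
  fixes B :: "'x \<Rightarrow> complex mat"
  assumes "\<forall>\<^sub>F x in F. B x \<in> carrier_mat n n" "C \<in> carrier_mat n n"
    and "\<And>i j. i < n \<Longrightarrow> j < n \<Longrightarrow> ((\<lambda>x. B x $$ (i, j)) \<longlongrightarrow> C $$ (i, j)) F"
  shows "((\<lambda>x. det (B x)) \<longlongrightarrow> det C) F"
proof -
  have "((\<lambda>x. B x $$ (i, \<pi> i)) \<longlongrightarrow> C $$ (i, \<pi> i)) F"
    if "\<pi> permutes {0..<n}" "i \<in> {0..<n}" for \<pi> i
    using assms(3)[of i "\<pi> i"] permutes_in_image[OF that(1), of i] that(2) by simp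
  then have "((\<lambda>x. \<Sum>\<pi> | \<pi> permutes {0..<n}. signof \<pi> * (\<Prod>i = 0..<n. B x $$ (i, \<pi> i)))
      \<longlongrightarrow> det C) F"
    unfolding det_def'[OF assms(2)] by (intro tendsto_intros) auto
  moreover have "\<forall>\<^sub>F x in F. (\<Sum>\<pi> | \<pi> permutes {0..<n}. signof \<pi> * (\<Prod>i = 0..<n. B x $$ (i, \<pi> i)))
      = det (B x)"
    using assms(1) by eventually_elim (simp add: det_def')
  ultimately show ?thesis
    by (rule Lim_transform_eventually)
qed

lemma tendsto_adj_mat:
  fixes B :: "'x \<Rightarrow> complex mat"
  assumes "\<forall>\<^sub>F x in F. B x \<in> carrier_mat n n" "C \<in> carrier_mat n n"
    and "\<And>i j. i < n \<Longrightarrow> j < n \<Longrightarrow> ((\<lambda>x. B x $$ (i, j)) \<longlongrightarrow> C $$ (i, j)) F"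
    and "i < n" "j < n"
  shows "((\<lambda>x. adj_mat (B x) $$ (i, j)) \<longlongrightarrow> adj_mat C $$ (i, j)) F"
proof -
  have det: "((\<lambda>x. det (mat_delete (B x) j i)) \<longlongrightarrow> det (mat_delete C j i)) F"
  proof (rule tendsto_det[where n = "n - 1"])
    show "\<forall>\<^sub>F x in F. mat_delete (B x) j i \<in> carrier_mat (n - 1) (n - 1)"
      using assms(1) by eventually_elim (auto simp: mat_delete_def)
    show "mat_delete C j i \<in> carrier_mat (n - 1) (n - 1)"
      using assms(2) by (auto simp: mat_delete_def)
    fix k l assume kl: "k < n - 1" "l < n - 1"
    have entry: "mat_delete D j i $$ (k, l) =
        D $$ (if k < j then k else Suc k, if l < i then l else Suc l)"
      if "D \<in> carrier_mat n n" for D :: "complex mat"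
      using that kl by (auto simp: mat_delete_def)
    have "((\<lambda>x. B x $$ (if k < j then k else Suc k, if l < i then l else Suc l))
        \<longlongrightarrow> mat_delete C j i $$ (k, l)) F"
      unfolding entry[OF assms(2)] by (rule assms(3)) (use kl in auto)
    then show "((\<lambda>x. mat_delete (B x) j i $$ (k, l)) \<longlongrightarrow> mat_delete C j i $$ (k, l)) F"
      by (rule Lim_transform_eventually)
         (use assms(1) in \<open>auto elim!: eventually_mono simp: entry\<close>)
  qed
  have entry: "adj_mat D $$ (i, j) = (- 1) ^ (j + i) * det (mat_delete D j i)"
    if "D \<in> carrier_mat n n" for D :: "complex mat"
    using that assms(4,5) by (auto simp: adj_mat_def cofactor_def)
  have "((\<lambda>x. (- 1) ^ (j + i) * det (mat_delete (B x) j i)) \<longlongrightarrow> adj_mat C $$ (i, j)) F"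
    unfolding entry[OF assms(2)] by (intro tendsto_intros det)
  then show ?thesis
    by (rule Lim_transform_eventually)
       (use assms(1) in \<open>auto elim!: eventually_mono simp: entry\<close>)
qed

section \<open>First-order perturbation of an eigenvalue\<close>

lemma scalar_prod_mult_mat_vec:
  fixes M :: "complex mat"
  assumes "M \<in> carrier_mat n n" "r \<in> carrier_vec n" "y \<in> carrier_vec n"
  shows "y \<bullet> (M *\<^sub>v r) = (\<Sum>i<n. \<Sum>j<n. y $ i * (M $$ (i, j) * r $ j))"
  using assms by (simp add: scalar_prod_def sum_distrib_left atLeast0LessThan)

text \<open>The form in which a left eigenvector is used: as a linear functional that intertwines \<open>M\<close> with
  multiplication by \<open>z\<close>.\<close>

lemma left_eigenvector_scalar_prod:
  assumes M: "M \<in> carrier_mat n n" and v: "left_eigenvector M v z" and r: "r \<in> carrier_vec n"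
  shows "conjugate v \<bullet> (M *\<^sub>v r) = z * (conjugate v \<bullet> r)"
proof -
  have "v \<in> carrier_vec n"
    using v M by (auto simp: left_eigenvector_def)
  then have c: "conjugate v \<in> carrier_vec n" by simp
  then have R: "mat_of_row (conjugate v) \<in> carrier_mat 1 n"
    by (metis carrier_vecD mat_of_row_carrier(1))
  have row: "(mat_of_row (conjugate v) *\<^sub>v x) $ 0 = conjugate v \<bullet> x" for x
    by simp
  have "conjugate v \<bullet> (M *\<^sub>v r) = ((mat_of_row (conjugate v) * M) *\<^sub>v r) $ 0"
    unfolding assoc_mult_mat_vec[OF R M r] row ..
  also have "\<dots> = ((z \<cdot>\<^sub>m mat_of_row (conjugate v)) *\<^sub>v r) $ 0"
    using v by (simp add: left_eigenvector_def)
  also have "\<dots> = z * (conjugate v \<bullet> r)"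
    using c r by simp
  finally show ?thesis .
qed

text \<open>Multiplying \<open>A x r(x) = z(x) r(x)\<close> by \<open>y\<close> and subtracting \<open>y A(w) r(x) = z(w) y r(x)\<close> leaves
  only increments of \<open>A\<close> and \<open>z\<close>. So \<open>r\<close> is never differentiated, and its continuity at \<open>w\<close> suffices
  for passing to the limit.\<close>

lemma first_order_eigenvalue_perturbation:
  fixes A :: "complex \<Rightarrow> complex mat" and r :: "complex \<Rightarrow> complex Matrix.vec"
  assumes S: "open S" "w \<in> S"
    and A: "\<And>x. x \<in> S \<Longrightarrow> A x \<in> carrier_mat n n"
    and diff: "\<And>i j. i < n \<Longrightarrow> j < n \<Longrightarrow> (\<lambda>x. A x $$ (i, j)) field_differentiable at w"
    and z: "(z has_field_derivative z') (at w)"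
    and r: "\<And>x. x \<in> S \<Longrightarrow> r x \<in> carrier_vec n" "\<And>x. x \<in> S \<Longrightarrow> A x *\<^sub>v r x = z x \<cdot>\<^sub>v r x"
    and cont: "\<And>i. i < n \<Longrightarrow> ((\<lambda>x. r x $ i) \<longlongrightarrow> r w $ i) (at w)"
    and y: "y \<in> carrier_vec n" "\<And>s. s \<in> carrier_vec n \<Longrightarrow> y \<bullet> (A w *\<^sub>v s) = z w * (y \<bullet> s)"
  shows "z' * (y \<bullet> r w) = y \<bullet> (mat_deriv A w *\<^sub>v r w)"
proof -
  define L where "L = (\<lambda>x. (z x - z w) / (x - w) * (\<Sum>i<n. y $ i * r x $ i))"
  define R where "R = (\<lambda>x. \<Sum>i<n. \<Sum>j<n. y $ i * ((A x $$ (i, j) - A w $$ (i, j)) / (x - w) * r x $ j))"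
  have prod: "y \<bullet> s = (\<Sum>i<n. y $ i * s $ i)" if "s \<in> carrier_vec n" for s
    using that by (simp add: scalar_prod_def atLeast0LessThan)
  have "(L \<longlongrightarrow> z' * (y \<bullet> r w)) (at w)"
    unfolding L_def prod[OF r(1)[OF S(2)]]
    using z by (intro tendsto_intros cont) (auto simp: has_field_derivative_iff)
  moreover have "(R \<longlongrightarrow> y \<bullet> (mat_deriv A w *\<^sub>v r w)) (at w)"
  proof -
    have "((\<lambda>x. (A x $$ (i, j) - A w $$ (i, j)) / (x - w)) \<longlongrightarrow> mat_deriv A w $$ (i, j)) (at w)"
      if "i < n" "j < n" for i j
      using DERIV_deriv_iff_field_differentiable[THEN iffD2, OF diff[OF that]] that A[OF S(2)]
      by (simp add: mat_deriv_def has_field_derivative_iff)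
    moreover have "mat_deriv A w \<in> carrier_mat n n"
      using A[OF S(2)] by (simp add: mat_deriv_def)
    ultimately show ?thesis
      unfolding R_def scalar_prod_mult_mat_vec[OF \<open>mat_deriv A w \<in> carrier_mat n n\<close> r(1)[OF S(2)] y(1)]
      by (intro tendsto_intros cont) auto
  qed
  moreover have "\<forall>\<^sub>F x in at w. L x = R x"
  proof -
    have "L x = R x" if "x \<in> S" for x
    proof -
      note rx = r(1)[OF that]
      have "(z x - z w) * (y \<bullet> r x) = y \<bullet> (A x *\<^sub>v r x) - y \<bullet> (A w *\<^sub>v r x)"
        using y rx r(2)[OF that] by (simp add: left_diff_distrib)
      also have "\<dots> = (\<Sum>i<n. \<Sum>j<n. y $ i * ((A x $$ (i, j) - A w $$ (i, j)) * r x $ j))"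
        unfolding scalar_prod_mult_mat_vec[OF A[OF that] rx y(1)]
          scalar_prod_mult_mat_vec[OF A[OF S(2)] rx y(1)]
        by (simp add: sum_subtractf algebra_simps)
      finally show ?thesis
        by (simp add: L_def R_def prod[OF rx] flip: sum_divide_distrib)
    qed
    then show ?thesis
      using eventually_at_in_open'[OF S] by (auto elim: eventually_mono)
  qed
  ultimately show ?thesis
    using tendsto_unique[OF trivial_limit_at] tendsto_cong by metis
qed

lemma char_matrix_uminus_index:
  assumes "M \<in> carrier_mat n n" "i < n" "j < n"
  shows "(- char_matrix M t) $$ (i, j) = (if i = j then t else 0) - M $$ (i, j)"
  using assms by (auto simp: char_matrix_def)

lemma char_matrix_uminus_mult_vec:
  assumes M: "M \<in> carrier_mat n n" and s: "s \<in> carrier_vec n"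
  shows "(- char_matrix M t) *\<^sub>v s = t \<cdot>\<^sub>v s - M *\<^sub>v s"
proof (rule eq_vecI)
  fix i assume i: "i < dim_vec (t \<cdot>\<^sub>v s - M *\<^sub>v s)"
  then have "i < n" using M by simp
  have C: "- char_matrix M t \<in> carrier_mat n n" using M by simp
  have "((- char_matrix M t) *\<^sub>v s) $ i = (\<Sum>j<n. (- char_matrix M t) $$ (i, j) * s $ j)"
    using \<open>i < n\<close> s carrier_matD[OF C] by (simp add: scalar_prod_def atLeast0LessThan del: index_uminus_mat)
  also have "\<dots> = (\<Sum>j<n. (if j = i then t * s $ j else 0) - M $$ (i, j) * s $ j)"
    using \<open>i < n\<close>
    by (intro sum.cong) (auto simp: char_matrix_uminus_index[OF M] algebra_simps simp del: index_uminus_mat)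
  also have "\<dots> = (t \<cdot>\<^sub>v s - M *\<^sub>v s) $ i"
    using \<open>i < n\<close> M s by (simp add: sum_subtractf scalar_prod_def atLeast0LessThan)
  finally show "((- char_matrix M t) *\<^sub>v s) $ i = (t \<cdot>\<^sub>v s - M *\<^sub>v s) $ i" .
qed (use M in \<open>simp add: char_matrix_def\<close>)

text \<open>For \<open>t \<noteq> z\<close>, applying the adjugate to \<open>(t I - M) u = (t - z) u\<close> gives
  \<open>adj (t I - M) u = (p(t) / (t - z)) u\<close>, where \<open>p\<close> is the characteristic polynomial. If \<open>u\<close> is
  nonzero, then \<open>p(z) = 0\<close>, and the factor tends to \<open>p'(z)\<close> for \<open>t \<rightarrow> z\<close>.\<close>

lemma adj_mat_eigenvector:
  fixes M :: "complex mat"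
  assumes M: "M \<in> carrier_mat n n" and u: "u \<in> carrier_vec n" "M *\<^sub>v u = z \<cdot>\<^sub>v u"
  shows "adj_mat (- char_matrix M z) *\<^sub>v u = poly (pderiv (char_poly M)) z \<cdot>\<^sub>v u"
proof (rule eq_vecI)
  define N where "N = (\<lambda>t. adj_mat (- char_matrix M t))"
  have C: "- char_matrix M t \<in> carrier_mat n n" for t
    using M by simp
  have N: "N t \<in> carrier_mat n n" for t
    unfolding N_def by (rule adj_mat(1)[OF C])
  have scaled: "(t - z) \<cdot>\<^sub>v (N t *\<^sub>v u) = poly (char_poly M) t \<cdot>\<^sub>v u" for t
  proof -
    have "(- char_matrix M t) *\<^sub>v u = (t - z) \<cdot>\<^sub>v u"
      unfolding char_matrix_uminus_mult_vec[OF M u(1)] u(2)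
      by (rule eq_vecI) (use u in \<open>auto simp: algebra_simps\<close>)
    then have "(N t * (- char_matrix M t)) *\<^sub>v u = (t - z) \<cdot>\<^sub>v (N t *\<^sub>v u)"
      using assoc_mult_mat_vec[OF N C u(1)] mult_mat_vec[OF N u(1)] by simp
    moreover have "N t * (- char_matrix M t) = poly (char_poly M) t \<cdot>\<^sub>m 1\<^sub>m n"
      unfolding N_def adj_mat(3)[OF C] char_poly_matrix[OF M] ..
    moreover have "(c \<cdot>\<^sub>m 1\<^sub>m n) *\<^sub>v u = c \<cdot>\<^sub>v u" for c :: complex
      using u(1) by (intro eq_vecI) (auto simp: scalar_prod_left_unit)
    ultimately show ?thesis by simp
  qed
  fix i assume "i < dim_vec (poly (pderiv (char_poly M)) z \<cdot>\<^sub>v u)"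
  then have i: "i < n" using u by simp
  have eq: "(t - z) * (N t *\<^sub>v u) $ i = poly (char_poly M) t * u $ i" for t
    using arg_cong[OF scaled[of t], of "\<lambda>s. vec_index s i"] i u(1) N[of t] by simp
  have entry: "(N t *\<^sub>v u) $ i = (\<Sum>j<n. N t $$ (i, j) * u $ j)" for t
    using i u(1) N[of t] by (simp add: scalar_prod_def atLeast0LessThan)
  have "((\<lambda>t. (N t *\<^sub>v u) $ i) \<longlongrightarrow> (N z *\<^sub>v u) $ i) (at z)"
    unfolding entry unfolding N_def
    by (intro tendsto_intros tendsto_adj_mat[where n = n])
       (use C i in \<open>auto simp: char_matrix_uminus_index[OF M] simp del: index_uminus_mat
         intro!: tendsto_intros\<close>)
  moreover have "((\<lambda>t. (N t *\<^sub>v u) $ i) \<longlongrightarrow> poly (pderiv (char_poly M)) z * u $ i) (at z)"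
  proof (rule Lim_transform_eventually)
    show "((\<lambda>t. (poly (char_poly M) t - poly (char_poly M) z) / (t - z) * u $ i)
        \<longlongrightarrow> poly (pderiv (char_poly M)) z * u $ i) (at z)"
      using poly_DERIV[of "char_poly M" z]
      by (intro tendsto_intros) (simp add: has_field_derivative_iff)
    \<comment> \<open>Since \<open>u = 0\<close> is permitted, \<open>z\<close> may fail to be a root; the product vanishes in any case.\<close>
    have "poly (char_poly M) z * u $ i = 0"
      using eq[of z] by simp
    then show "\<forall>\<^sub>F t in at z. (poly (char_poly M) t - poly (char_poly M) z) / (t - z) * u $ i
        = (N t *\<^sub>v u) $ i"
      using eq by (auto simp: eventually_at_filter left_diff_distrib field_simps)
  qed
  ultimately have "(N z *\<^sub>v u) $ i = poly (pderiv (char_poly M)) z * u $ i"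
    using tendsto_unique[OF trivial_limit_at] by blast
  then show "(adj_mat (- char_matrix M z) *\<^sub>v u) $ i = (poly (pderiv (char_poly M)) z \<cdot>\<^sub>v u) $ i"
    using i u(1) by (simp add: N_def)
qed (use adj_mat(1)[of "- char_matrix M z" n] M u in simp)

text \<open>The vectors \<open>adj (z(x) I - A(x)) u\<close> solve the eigenvalue equation for every \<open>x \<in> S\<close>, are
  continuous in \<open>x\<close> at \<open>w\<close>, and equal a nonzero multiple of \<open>u\<close> there. This is
  what links an arbitrarily chosen \<open>u\<close> to the neighbouring matrices. The formula is stated without
  division, because it is used below to show that \<open>v\<^sup>* u\<close> is nonzero.\<close>

theorem eigenvalue_derivative:
  assumes S: "open S" "w \<in> S"
    and A: "\<And>x. x \<in> S \<Longrightarrow> A x \<in> carrier_mat n n"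
    and diff: "\<And>i j. i < n \<Longrightarrow> j < n \<Longrightarrow> (\<lambda>x. A x $$ (i, j)) field_differentiable at w"
    and z: "(z has_field_derivative z') (at w)"
    and root: "\<And>x. x \<in> S \<Longrightarrow> poly (char_poly (A x)) (z x) = 0"
    and simple: "poly (pderiv (char_poly (A w))) (z w) \<noteq> 0"
    and u: "eigenvector (A w) u (z w)"
    and v: "left_eigenvector (A w) v (z w)"
  shows "z' * (conjugate v \<bullet> u) = conjugate v \<bullet> (mat_deriv A w *\<^sub>v u)"
proof -
  define C where "C = (\<lambda>x. - char_matrix (A x) (z x))"
  define r where "r = (\<lambda>x. adj_mat (C x) *\<^sub>v u)"
  define c where "c = poly (pderiv (char_poly (A w))) (z w)"
  note Aw = A[OF S(2)]
  have u': "u \<in> carrier_vec n" "A w *\<^sub>v u = z w \<cdot>\<^sub>v u"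
    using u Aw by (auto simp: eigenvector_def)
  have v': "conjugate v \<in> carrier_vec n"
    using v Aw by (auto simp: left_eigenvector_def)
  have C: "C x \<in> carrier_mat n n" if "x \<in> S" for x
    using A[OF that] by (simp add: C_def)
  have r: "r x \<in> carrier_vec n" "A x *\<^sub>v r x = z x \<cdot>\<^sub>v r x" if "x \<in> S" for x
  proof -
    note adj = adj_mat[OF C[OF that]]
    show rx: "r x \<in> carrier_vec n"
      using adj(1) u'(1) by (simp add: r_def)
    have "C x *\<^sub>v r x = (C x * adj_mat (C x)) *\<^sub>v u"
      using adj(1) C[OF that] u'(1) by (simp add: r_def)
    also have "\<dots> = (poly (char_poly (A x)) (z x) \<cdot>\<^sub>m 1\<^sub>m n) *\<^sub>v u"
      unfolding adj(2) unfolding C_def char_poly_matrix[OF A[OF that]] ..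
    also have "\<dots> = 0\<^sub>v n"
      using u'(1) by (intro eq_vecI) (auto simp: root[OF that] scalar_prod_def)
    finally have "z x \<cdot>\<^sub>v r x - A x *\<^sub>v r x = 0\<^sub>v n"
      using A[OF that] by (simp add: C_def char_matrix_uminus_mult_vec[OF A[OF that] rx])
    then have "(z x \<cdot>\<^sub>v r x - A x *\<^sub>v r x) $ i = 0" if "i < n" for i
      using that by simp
    then show "A x *\<^sub>v r x = z x \<cdot>\<^sub>v r x"
      using A[OF that] rx by (intro eq_vecI) auto
  qed
  have rw: "r w = c \<cdot>\<^sub>v u"
    unfolding r_def C_def c_def by (rule adj_mat_eigenvector[OF Aw u'])
  have ev: "\<forall>\<^sub>F x in at w. x \<in> S"
    by (rule eventually_at_in_open'[OF S])
  have C_tendsto: "((\<lambda>x. C x $$ (i, j)) \<longlongrightarrow> C w $$ (i, j)) (at w)" if "i < n" "j < n" for i j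
  proof (rule Lim_transform_eventually)
    have "isCont (\<lambda>x. A x $$ (i, j)) w"
      by (rule field_differentiable_imp_continuous_at[OF diff[OF that]])
    moreover have "isCont z w"
      using z by (rule DERIV_isCont)
    ultimately show "((\<lambda>x. (if i = j then z x else 0) - A x $$ (i, j)) \<longlongrightarrow> C w $$ (i, j)) (at w)"
      unfolding C_def char_matrix_uminus_index[OF Aw that]
      by (cases "i = j") (auto simp: isCont_def intro!: tendsto_intros)
    show "\<forall>\<^sub>F x in at w. (if i = j then z x else 0) - A x $$ (i, j) = C x $$ (i, j)"
      using ev by eventually_elim (simp only: C_def char_matrix_uminus_index[OF A that])
  qed
  have "((\<lambda>x. r x $ i) \<longlongrightarrow> r w $ i) (at w)" if i: "i < n" for i
  proof (rule Lim_transform_eventually)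
    have entry: "r x $ i = (\<Sum>j<n. adj_mat (C x) $$ (i, j) * u $ j)" if "x \<in> S" for x
      using i u'(1) adj_mat(1)[OF C[OF that]] by (simp add: r_def scalar_prod_def atLeast0LessThan)
    show "((\<lambda>x. \<Sum>j<n. adj_mat (C x) $$ (i, j) * u $ j) \<longlongrightarrow> r w $ i) (at w)"
      unfolding entry[OF S(2)]
    proof (intro tendsto_intros tendsto_adj_mat[where n = n])
      show "\<forall>\<^sub>F x in at w. C x \<in> carrier_mat n n"
        using ev by eventually_elim (rule C)
    qed (use C[OF S(2)] C_tendsto i in auto)
    show "\<forall>\<^sub>F x in at w. (\<Sum>j<n. adj_mat (C x) $$ (i, j) * u $ j) = r x $ i"
      using ev by eventually_elim (simp add: entry)
  qed
  then have "z' * (conjugate v \<bullet> r w) = conjugate v \<bullet> (mat_deriv A w *\<^sub>v r w)"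
    using left_eigenvector_scalar_prod[OF Aw v] v' r
    by (intro first_order_eigenvalue_perturbation[OF S A diff z]) auto
  moreover have "mat_deriv A w \<in> carrier_mat n n"
    using Aw by (simp add: mat_deriv_def)
  ultimately have "c * (z' * (conjugate v \<bullet> u)) = c * (conjugate v \<bullet> (mat_deriv A w *\<^sub>v u))"
    using u'(1) v' by (simp add: rw mult_mat_vec mult.left_commute)
  then show ?thesis
    using simple by (simp add: c_def)
qed

text \<open>If \<open>v\<^sup>* u\<close> were \<open>0\<close>, then by the previous theorem every holomorphic perturbation \<open>A\<close> of \<open>M\<close> would
  satisfy \<open>v\<^sup>* A' u = 0\<close>. The direction \<open>v u\<^sup>*\<close> violates this.\<close>

lemma left_right_eigenvectors_not_orthogonal:
  assumes M: "M \<in> carrier_mat n n"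
    and simple: "poly (pderiv (char_poly M)) z \<noteq> 0"
    and u: "eigenvector M u z" and v: "left_eigenvector M v z"
  shows "conjugate v \<bullet> u \<noteq> 0"
proof
  assume orth: "conjugate v \<bullet> u = 0"
  have u': "u \<in> carrier_vec n" "u \<noteq> 0\<^sub>v n" and v': "v \<in> carrier_vec n" "v \<noteq> 0\<^sub>v n"
    using u v M by (auto simp: eigenvector_def left_eigenvector_def)
  define A where "A = (\<lambda>s. Matrix.mat n n (\<lambda>(i, j). M $$ (i, j) + s * (v $ i * conjugate u $ j)))"
  have A: "A s \<in> carrier_mat n n" for s by (simp add: A_def)
  have A0: "A 0 = M"
    using M by (auto simp: A_def intro!: eq_matI)
  have entry: "(\<lambda>s. A s $$ (i, j)) = (\<lambda>s. M $$ (i, j) + s * (v $ i * conjugate u $ j))"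
    if "i < n" "j < n" for i j
    using that by (simp add: A_def)
  have hol: "(\<lambda>s. A s $$ (i, j)) holomorphic_on UNIV" if "i < n" "j < n" for i j
    unfolding entry[OF that] by (intro holomorphic_intros)
  have root: "poly (char_poly (A 0)) z = 0"
    using u eigenvalue_root_char_poly[OF M] by (auto simp: A0 eigenvalue_def)
  obtain \<epsilon> \<delta> \<zeta> where \<zeta>: "\<epsilon> > 0" "\<delta> > 0" "\<zeta> holomorphic_on ball 0 \<epsilon>"
      "\<And>s. s \<in> ball 0 \<epsilon> \<Longrightarrow> poly (char_poly (A s)) (\<zeta> s) = 0"
      "\<And>s \<mu>. s \<in> ball 0 \<epsilon> \<Longrightarrow> \<mu> \<in> ball z \<delta> \<Longrightarrow> poly (char_poly (A s)) \<mu> = 0 \<Longrightarrow> \<mu> = \<zeta> s"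
  proof (rule simple_root_holomorphic[of UNIV 0 "\<lambda>s. char_poly (A s)" n z])
    show "degree (char_poly (A s)) \<le> n" for s
      using degree_monic_char_poly[OF A] by simp
    show "(\<lambda>s. coeff (char_poly (A s)) k) holomorphic_on UNIV" for k
      by (rule coeff_char_poly_holomorphic[OF A hol])
  qed (use root simple in \<open>auto simp: A0\<close>)
  have \<zeta>0: "\<zeta> 0 = z"
    using \<zeta>(5)[of 0 z] root \<zeta>(1,2) by simp
  obtain \<zeta>' where "(\<zeta> has_field_derivative \<zeta>') (at 0)"
    using \<zeta>(1,3) by (metis centre_in_ball field_differentiable_def holomorphic_on_imp_differentiable_at open_ball)
  then have "\<zeta>' * (conjugate v \<bullet> u) = conjugate v \<bullet> (mat_deriv A 0 *\<^sub>v u)"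
  proof (rule eigenvalue_derivative[of "ball 0 \<epsilon>" 0 A n \<zeta>, rotated 4])
    show "(\<lambda>s. A s $$ (i, j)) field_differentiable at 0" if "i < n" "j < n" for i j
      by (rule holomorphic_on_imp_differentiable_at[OF hol[OF that]]) auto
  qed (use \<zeta>(1,4) simple u v A in \<open>auto simp: A0 \<zeta>0\<close>)
  also have "mat_deriv A 0 *\<^sub>v u = (conjugate u \<bullet> u) \<cdot>\<^sub>v v"
  proof (rule eq_vecI)
    fix i assume "i < dim_vec ((conjugate u \<bullet> u) \<cdot>\<^sub>v v)"
    then have i: "i < n" using v' by simp
    have "mat_deriv A 0 $$ (i, j) = v $ i * conjugate u $ j" if "j < n" for j
    proof -
      have "((\<lambda>s. M $$ (i, j) + s * (v $ i * conjugate u $ j)) has_field_derivative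
          v $ i * conjugate u $ j) (at 0)"
        by (auto intro!: derivative_eq_intros)
      then show ?thesis
        using i that A[of 0] by (simp add: mat_deriv_def entry DERIV_imp_deriv)
    qed
    moreover have "mat_deriv A 0 \<in> carrier_mat n n"
      using A[of 0] by (simp add: mat_deriv_def)
    ultimately show "(mat_deriv A 0 *\<^sub>v u) $ i = ((conjugate u \<bullet> u) \<cdot>\<^sub>v v) $ i"
      using i u'(1) v'(1) by (simp add: scalar_prod_def sum_distrib_left mult_ac)
  qed (use A[of 0] v' in \<open>simp add: mat_deriv_def\<close>)
  also have "conjugate v \<bullet> ((conjugate u \<bullet> u) \<cdot>\<^sub>v v) = (conjugate u \<bullet> u) * (conjugate v \<bullet> v)"
    using v'(1) by simp
  finally have "(conjugate u \<bullet> u) * (conjugate v \<bullet> v) = 0"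
    using orth by simp
  moreover have "conjugate s \<bullet> s \<noteq> 0" if "s \<in> carrier_vec n" "s \<noteq> 0\<^sub>v n" for s :: "complex Matrix.vec"
    using that conjugate_square_eq_0_vec[of s n] comm_scalar_prod[of s n "conjugate s"] by simp
  ultimately show False
    using u' v' by simp
qed

section \<open>Simple eigenvalues of analytic matrix functions\<close>

theorem proposition3p1:
  fixes F :: "complex set" and \<Omega> :: "complex set" and n :: nat
    and A :: "complex \<Rightarrow> complex mat" and \<omega>\<^sub>0 z\<^sub>0 :: complex
  assumes "F = \<real> \<or> F = UNIV"
    and "open \<Omega>" and "\<omega>\<^sub>0 \<in> \<Omega>"
    and "\<And>\<omega>. \<omega> \<in> \<Omega> \<Longrightarrow> A \<omega> \<in> carrier_mat n n \<and> elements_mat (A \<omega>) \<subseteq> F"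
    and "\<And>i j. i < n \<Longrightarrow> j < n \<Longrightarrow> (\<lambda>\<omega>. A \<omega> $$ (i, j)) analytic_on {\<omega>\<^sub>0}"
    and "simple_eigenvalue (A \<omega>\<^sub>0) z\<^sub>0"
  shows "\<exists>\<epsilon>>0. \<exists>\<delta>>0. \<exists>z :: complex \<Rightarrow> complex.
      ball \<omega>\<^sub>0 \<epsilon> \<subseteq> \<Omega> \<and>
      (\<forall>i<n. \<forall>j<n. (\<lambda>\<omega>. A \<omega> $$ (i, j)) analytic_on ball \<omega>\<^sub>0 \<epsilon>) \<and>
      (\<forall>\<omega>\<in>ball \<omega>\<^sub>0 \<epsilon>.
         z \<omega> \<in> ball z\<^sub>0 \<delta> \<and> eigenvalue (A \<omega>) (z \<omega>) \<and>
         (\<forall>\<mu>\<in>ball z\<^sub>0 \<delta>. eigenvalue (A \<omega>) \<mu> \<longrightarrow> \<mu> = z \<omega>)) \<and>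
      z analytic_on ball \<omega>\<^sub>0 \<epsilon> \<and>
      (\<forall>\<omega>\<in>ball \<omega>\<^sub>0 \<epsilon>. \<forall>u v.
         eigenvector (A \<omega>) u (z \<omega>) \<and> left_eigenvector (A \<omega>) v (z \<omega>) \<longrightarrow>
         conjugate v \<bullet> u \<noteq> 0 \<and>
         deriv z \<omega> = (conjugate v \<bullet> (mat_deriv A \<omega> *\<^sub>v u)) / (conjugate v \<bullet> u))"
proof -
  note \<Omega> = assms(2,3)
  have A: "A \<omega> \<in> carrier_mat n n" if "\<omega> \<in> \<Omega>" for \<omega>
    using assms(4)[OF that] by blast
  obtain U where U: "\<And>i j. i < n \<Longrightarrow> j < n \<Longrightarrow>
      open (U i j) \<and> \<omega>\<^sub>0 \<in> U i j \<and> (\<lambda>\<omega>. A \<omega> $$ (i, j)) holomorphic_on U i j"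
    using assms(5) unfolding analytic_at by metis
  \<comment> \<open>Analyticity at a point provides a separate neighbourhood for each of the finitely many entries.\<close>
  define S where "S = \<Omega> \<inter> (\<Inter>i<n. \<Inter>j<n. U i j)"
  have S: "open S" "\<omega>\<^sub>0 \<in> S" "S \<subseteq> \<Omega>"
    using \<Omega> U by (auto simp: S_def intro!: open_Int open_INT)
  have hol: "(\<lambda>\<omega>. A \<omega> $$ (i, j)) holomorphic_on S" if "i < n" "j < n" for i j
    by (rule holomorphic_on_subset[of _ "U i j"]) (use U that in \<open>auto simp: S_def\<close>)
  have AS: "A \<omega> \<in> carrier_mat n n" if "\<omega> \<in> S" for \<omega>
    using A S(3) that by blast
  have eig: "eigenvalue (A \<omega>) \<mu> \<longleftrightarrow> poly (char_poly (A \<omega>)) \<mu> = 0" if "\<omega> \<in> S" for \<omega> \<mu>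
    by (rule eigenvalue_root_char_poly[OF AS[OF that]])
  obtain \<epsilon> \<delta> z where z: "\<epsilon> > 0" "\<delta> > 0" "ball \<omega>\<^sub>0 \<epsilon> \<subseteq> S" "z holomorphic_on ball \<omega>\<^sub>0 \<epsilon>"
      "\<And>\<omega>. \<omega> \<in> ball \<omega>\<^sub>0 \<epsilon> \<Longrightarrow> z \<omega> \<in> ball z\<^sub>0 \<delta>"
      "\<And>\<omega>. \<omega> \<in> ball \<omega>\<^sub>0 \<epsilon> \<Longrightarrow> poly (char_poly (A \<omega>)) (z \<omega>) = 0"
      "\<And>\<omega>. \<omega> \<in> ball \<omega>\<^sub>0 \<epsilon> \<Longrightarrow> poly (pderiv (char_poly (A \<omega>))) (z \<omega>) \<noteq> 0"
      "\<And>\<omega> \<mu>. \<omega> \<in> ball \<omega>\<^sub>0 \<epsilon> \<Longrightarrow> \<mu> \<in> ball z\<^sub>0 \<delta> \<Longrightarrow> poly (char_poly (A \<omega>)) \<mu> = 0 \<Longrightarrow> \<mu> = z \<omega>"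
  proof (rule simple_root_holomorphic[of S \<omega>\<^sub>0 "\<lambda>\<omega>. char_poly (A \<omega>)" n z\<^sub>0])
    show "degree (char_poly (A \<omega>)) \<le> n" if "\<omega> \<in> S" for \<omega>
      using degree_monic_char_poly[OF AS[OF that]] by simp
    show "(\<lambda>\<omega>. coeff (char_poly (A \<omega>)) k) holomorphic_on S" for k
      by (rule coeff_char_poly_holomorphic[OF AS hol])
    show "poly (char_poly (A \<omega>\<^sub>0)) z\<^sub>0 = 0"
      using assms(6) eig[OF S(2)] by (simp add: simple_eigenvalue_def)
    show "poly (pderiv (char_poly (A \<omega>\<^sub>0))) z\<^sub>0 \<noteq> 0"
      by (rule simple_eigenvalue_imp_pderiv_char_poly_nonzero[OF AS[OF S(2)] assms(6)])
  qed (use S in auto)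
  have formula: "conjugate v \<bullet> u \<noteq> 0 \<and>
      deriv z \<omega> = (conjugate v \<bullet> (mat_deriv A \<omega> *\<^sub>v u)) / (conjugate v \<bullet> u)"
    if \<omega>: "\<omega> \<in> ball \<omega>\<^sub>0 \<epsilon>"
      and uv: "eigenvector (A \<omega>) u (z \<omega>)" "left_eigenvector (A \<omega>) v (z \<omega>)" for \<omega> u v
  proof -
    have \<omega>S: "\<omega> \<in> S" using \<omega> z(3) by blast
    have ne: "conjugate v \<bullet> u \<noteq> 0"
      by (rule left_right_eigenvectors_not_orthogonal[OF AS[OF \<omega>S] z(7)[OF \<omega>] uv])
    have "deriv z \<omega> * (conjugate v \<bullet> u) = conjugate v \<bullet> (mat_deriv A \<omega> *\<^sub>v u)"
    proof (rule eigenvalue_derivative[of "ball \<omega>\<^sub>0 \<epsilon>" \<omega> A n z])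
      show "(\<lambda>x. A x $$ (i, j)) field_differentiable at \<omega>" if "i < n" "j < n" for i j
        by (rule holomorphic_on_imp_differentiable_at[OF hol[OF that] S(1) \<omega>S])
      show "(z has_field_derivative deriv z \<omega>) (at \<omega>)"
        by (rule holomorphic_derivI[OF z(4) open_ball \<omega>])
    qed (use \<omega> z uv AS in auto)
    then show ?thesis
      using ne by (simp add: eq_divide_eq)
  qed
  have "(\<lambda>\<omega>. A \<omega> $$ (i, j)) analytic_on ball \<omega>\<^sub>0 \<epsilon>" if "i < n" "j < n" for i j
    using holomorphic_on_subset[OF hol[OF that] z(3)] by (simp add: analytic_on_open)
  moreover have "z analytic_on ball \<omega>\<^sub>0 \<epsilon>"
    using z(4) by (simp add: analytic_on_open)
  moreover have "ball \<omega>\<^sub>0 \<epsilon> \<subseteq> \<Omega>"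
    using z(3) S(3) by blast
  moreover have "z \<omega> \<in> ball z\<^sub>0 \<delta> \<and> eigenvalue (A \<omega>) (z \<omega>) \<and>
      (\<forall>\<mu>\<in>ball z\<^sub>0 \<delta>. eigenvalue (A \<omega>) \<mu> \<longrightarrow> \<mu> = z \<omega>)" if "\<omega> \<in> ball \<omega>\<^sub>0 \<epsilon>" for \<omega>
    using z(3,5,6,8) that by (auto simp: eig subset_iff)
  ultimately show ?thesis
    using z(1,2) formula by (intro exI[of _ \<epsilon>] exI[of _ \<delta>] exI[of _ z] conjI) auto
qed

end
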